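(* Let $T\ge 2$ and let the standing assumptions hold (domain diameter at most $D$, gradients bounded by $G$). Suppose that for some $\lambda\in[1/T,1]$ every $f_t$, $t=1,\dots,T$, is $\lambda$-strongly convex on $\mathcal{X}$. Let $\widehat{\lambda}\in\mathcal{P}_{str}$ satisfy $\widehat{\lambda}\le\lambda\le 2\widehat{\lambda}$ (such an element exists). Then the points $\mathbf{x}_1,\dots,\mathbf{x}_T$ produced by USC satisfy \[ \sum_{t=1}^T f_t(\mathbf{x}_t)-\min_{\mathbf{x}\in\mathcal{X}}\sum_{t=1}^T f_t(\mathbf{x})\le \min_{A\in\mathcal{A}_{str}} R(A,\widehat{\lambda}) + 2\Gamma GD\left(2+\frac{1}{\sqrt{\ln|\mathcal{E}|}}\right)+\frac{\Gamma^2G^2}{2\lambda\ln|\mathcal{E}|}. \] In particular, when $|\mathcal{A}_{str}|,|\mathcal{A}_{exp}|,|\mathcal{A}_{con}|$ are bounded by constants, the additive term is $O\big(\frac{\log\log T}{\lambda}\big)$.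
   Context: Setting (online convex optimization): $\mathcal{X}\subset\mathbb{R}^d$ is a nonempty closed convex set with $\max_{\mathbf{x},\mathbf{y}\in\mathcal{X}}\|\mathbf{x}-\mathbf{y}\|\le D$. For $t=1,\dots,T$, $f_t:\mathcal{X}\to\mathbb{R}$ are convex differentiable functions with $\max_{\mathbf{x}\in\mathcal{X}}\|\nabla f_t(\mathbf{x})\|\le G$. At round $t$ a learner outputs $\mathbf{x}_t\in\mathcal{X}$ depending only on $f_1,\dots,f_{t-1}$, then $f_t$ is revealed. An online algorithm (expert) is any such procedure. A function $f$ is $\lambda$-strongly convex on $\mathcal{X}$ if $f(\mathbf{y})\ge f(\mathbf{x})+\langle\nabla f(\mathbf{x}),\mathbf{y}-\mathbf{x}\rangle+\frac{\lambda}{2}\|\mathbf{y}-\mathbf{x}\|^2$ for all $\mathbf{x},\mathbf{y}\in\mathcal{X}$. Algorithm USC: Let $N=\lceil\log_2T\rceil$ and $\mathcal{P}_{str}=\mathcal{P}_{exp}=\{2^k/T: k=0,1,\dots,N\}$. Let $\mathcal{A}_{str},\mathcal{A}_{exp}$ be finite sets of online algorithms each taking a positive parameter, and $\mathcal{A}_{con}$ a finite set of online algorithms. The expert set $\mathcal{E}$ consists of the experts $E(A,\lambda')$ ($A$ run with parameter $\lambda'$) for $A\in\mathcal{A}_{str},\lambda'\in\mathcal{P}_{str}$; $E(A,\alpha')$ for $A\in\mathcal{A}_{exp},\alpha'\in\mathcal{P}_{exp}$; and $E(A)$ for $A\in\mathcal{A}_{con}$. Index them $E^1,\dots,E^{|\mathcal{E}|}$;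 every expert receives the full functions $f_1,f_2,\dots$ and outputs $\mathbf{x}_t^i\in\mathcal{X}$ at round $t$. Fix any $\bar{\mathbf{x}}\in\mathcal{X}$. USC outputs $\mathbf{x}_t=\sum_i p_t^i\mathbf{x}_t^i$ with weights given by Adapt-ML-Prod on the losses $\ell_t^i=\frac{\langle\nabla f_t(\mathbf{x}_t),\mathbf{x}_t^i-\bar{\mathbf{x}}\rangle+GD}{2GD}\in[0,1]$, $\ell_t=\sum_ip_t^i\ell_t^i$: namely $p_t^i=\eta_{t-1}^iw_{t-1}^i/\sum_j\eta_{t-1}^jw_{t-1}^j$, where $\eta_{t-1}^i=\min\{\frac12,\sqrt{\ln|\mathcal{E}|/(1+\sum_{s=1}^{t-1}(\ell_s-\ell_s^i)^2)}\}$ for $t\ge1$, $w_0^i=1/|\mathcal{E}|$, and $w_{t-1}^i=\big(w_{t-2}^i(1+\eta_{t-2}^i(\ell_{t-1}-\ell_{t-1}^i))\big)^{\eta_{t-1}^i/\eta_{t-2}^i}$ for $t\ge2$. Define $\Gamma=3\ln|\mathcal{E}|+\ln\big(1+\frac{|\mathcal{E}|}{2e}(1+\ln(T+1))\big)$. For $A\in\mathcal{A}_{str}$ and $\lambda'>0$, $R(A,\lambda')$ denotes a regret bound of $A$: a number such that whenever $f_1,\dots,f_T$ satisfy the setting and are all $\lambda'$-strongly convex, the outputs $\mathbf{y}_t$ of $A$ run with parameter $\lambda'$ satisfy $\sum_t f_t(\mathbf{y}_t)-\min_{\mathbf{x}\in\mathcal{X}}\sum_tf_t(\mathbf{x})\le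 R(A,\lambda')$. *)

theory Defs
  imports "HOL-Analysis.Analysis"
begin

text \<open>Sequences of loss functions are indexed by rounds: F t is f_t (rounds 1..T).
  A (deterministic) online algorithm maps the whole sequence of functions to a
  sequence of points; its output at round t may depend only on f_1,...,f_(t-1).\<close>

type_synonym 'a fseq = "nat \<Rightarrow> 'a \<Rightarrow> real"
type_synonym 'a online_alg = "'a fseq \<Rightarrow> nat \<Rightarrow> 'a"
type_synonym 'a param_alg = "real \<Rightarrow> 'a online_alg"

definition is_online_alg :: "'a set \<Rightarrow> 'a online_alg \<Rightarrow> bool" where
  "is_online_alg X alg \<longleftrightarrow>
     (\<forall>F t. 1 \<le> t \<longrightarrow> alg F t \<in> X) \<and>
     (\<forall>F F' t. (\<forall>s. 1 \<le> s \<and> s < t \<longrightarrow> F s = F' s) \<longrightarrow> alg F t = alg F' t)"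

definition oco_setting ::
  "'a::euclidean_space set \<Rightarrow> real \<Rightarrow> nat \<Rightarrow> 'a fseq \<Rightarrow> (nat \<Rightarrow> 'a \<Rightarrow> 'a) \<Rightarrow> bool" where
  "oco_setting X G T F gF \<longleftrightarrow>
     (\<forall>t\<in>{1..T}. convex_on X (F t) \<and>
        (\<forall>x\<in>X. (F t has_derivative (\<lambda>h. gF t x \<bullet> h)) (at x within X)) \<and>
        (\<forall>x\<in>X. norm (gF t x) \<le> G))"

definition strongly_convex_grad ::
  "'a::euclidean_space set \<Rightarrow> ('a \<Rightarrow> real) \<Rightarrow> ('a \<Rightarrow> 'a) \<Rightarrow> real \<Rightarrow> bool" where
  "strongly_convex_grad X f g lam \<longleftrightarrow>
     (\<forall>x\<in>X. \<forall>y\<in>X. f y \<ge> f x + g x \<bullet> (y - x) + lam / 2 * (norm (y - x))\<^sup>2)"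

definition regret :: "'a set \<Rightarrow> nat \<Rightarrow> 'a fseq \<Rightarrow> (nat \<Rightarrow> 'a) \<Rightarrow> real" where
  "regret X T F y = (\<Sum>t=1..T. F t (y t)) - (INF x\<in>X. \<Sum>t=1..T. F t x)"

definition is_str_regret_bound ::
  "'a::euclidean_space set \<Rightarrow> real \<Rightarrow> nat \<Rightarrow> 'a param_alg \<Rightarrow> real \<Rightarrow> real \<Rightarrow> bool" where
  "is_str_regret_bound X G T A lam' r \<longleftrightarrow>
     (\<forall>F gF. oco_setting X G T F gF \<and> (\<forall>t\<in>{1..T}. strongly_convex_grad X (F t) (gF t) lam')
        \<longrightarrow> regret X T F (A lam' F) \<le> r)"

definition Pgrid :: "nat \<Rightarrow> real set" where
  "Pgrid T = {2 ^ k / real T | k. k \<le> nat \<lceil>log 2 (real T)\<rceil>}"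

datatype 'a expert = EStr "'a param_alg" real | EExp "'a param_alg" real | ECon "'a online_alg"

fun expert_out :: "'a expert \<Rightarrow> 'a online_alg" where
  "expert_out (EStr A l) = A l"
| "expert_out (EExp A a) = A a"
| "expert_out (ECon A) = A"

definition usc_experts ::
  "'a param_alg set \<Rightarrow> 'a param_alg set \<Rightarrow> 'a online_alg set \<Rightarrow> nat \<Rightarrow> 'a expert set" where
  "usc_experts Astr Aexp Acon T =
     {EStr A l | A l. A \<in> Astr \<and> l \<in> Pgrid T} \<union>
     {EExp A a | A a. A \<in> Aexp \<and> a \<in> Pgrid T} \<union>
     {ECon A | A. A \<in> Acon}"

text \<open>Adapt-ML-Prod. The state after round t is (w_t, S_t) where
  S_t i = sum_{s=1}^t (l_s - l_s^i)^2, so eta_t^i = ml_eta |E| (S_t i).\<close>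

definition ml_eta :: "nat \<Rightarrow> real \<Rightarrow> real" where
  "ml_eta n S = min (1/2) (sqrt (ln (real n) / (1 + S)))"

definition ml_prob :: "'e set \<Rightarrow> ('e \<Rightarrow> real) \<Rightarrow> ('e \<Rightarrow> real) \<Rightarrow> 'e \<Rightarrow> real" where
  "ml_prob E w S i =
     ml_eta (card E) (S i) * w i / (\<Sum>j\<in>E. ml_eta (card E) (S j) * w j)"

definition ml_combine ::
  "'e set \<Rightarrow> ('e \<Rightarrow> nat \<Rightarrow> 'a::real_vector) \<Rightarrow> ('e \<Rightarrow> real) \<Rightarrow> ('e \<Rightarrow> real) \<Rightarrow> nat \<Rightarrow> 'a" where
  "ml_combine E out w S t = (\<Sum>i\<in>E. ml_prob E w S i *\<^sub>R out i t)"

definition usc_loss :: "real \<Rightarrow> real \<Rightarrow> 'a::real_inner \<Rightarrow> 'a \<Rightarrow> 'a \<Rightarrow> real" where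
  "usc_loss G D xb gr y = (gr \<bullet> (y - xb) + G * D) / (2 * G * D)"

fun usc_state ::
  "'e set \<Rightarrow> ('e \<Rightarrow> nat \<Rightarrow> 'a::real_inner) \<Rightarrow> (nat \<Rightarrow> 'a \<Rightarrow> 'a) \<Rightarrow> real \<Rightarrow> real \<Rightarrow> 'a
    \<Rightarrow> nat \<Rightarrow> ('e \<Rightarrow> real) \<times> ('e \<Rightarrow> real)" where
  "usc_state E out g G D xb 0 = ((\<lambda>i. 1 / real (card E)), (\<lambda>i. 0))"
| "usc_state E out g G D xb (Suc t) =
     (let (w, S) = usc_state E out g G D xb t;
          n = card E;
          x = ml_combine E out w S (Suc t);
          li = (\<lambda>i. usc_loss G D xb (g (Suc t) x) (out i (Suc t)));
          l = (\<Sum>i\<in>E. ml_prob E w S i * li i);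
          S' = (\<lambda>i. S i + (l - li i)\<^sup>2);
          w' = (\<lambda>i. (w i * (1 + ml_eta n (S i) * (l - li i)))
                       powr (ml_eta n (S' i) / ml_eta n (S i)))
      in (w', S'))"

definition USC ::
  "'a::euclidean_space param_alg set \<Rightarrow> 'a param_alg set \<Rightarrow> 'a online_alg set \<Rightarrow> nat
    \<Rightarrow> real \<Rightarrow> real \<Rightarrow> 'a \<Rightarrow> 'a fseq \<Rightarrow> (nat \<Rightarrow> 'a \<Rightarrow> 'a) \<Rightarrow> nat \<Rightarrow> 'a" where
  "USC Astr Aexp Acon T G D xb F gF t =
     (let E = usc_experts Astr Aexp Acon T;
          out = (\<lambda>i s. expert_out i F s);
          (w, S) = usc_state E out gF G D xb (t - 1)
      in ml_combine E out w S t)"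

definition usc_Gamma :: "nat \<Rightarrow> nat \<Rightarrow> real" where
  "usc_Gamma nE T = 3 * ln (real nE) + ln (1 + real nE / (2 * exp 1) * (1 + ln (real T + 1)))"

end

theory Submission
  imports Defs
begin

text \<open>USC plays a convex combination of its experts and the surrogate losses l_t^i are affine
  in the expert's point, so the Adapt-ML-Prod regret l_t - l_t^k against expert E^k is exactly
  the linearised regret <\<nabla>f_t(x_t), x_t - x_t^k> / (2GD).  The second-order bound of Adapt-ML-Prod controls that regret by
  \<Gamma>(2 + 1/\<surd>ln|E|) + \<Gamma>/\<surd>ln|E| \<cdot> (\<Sum>_t (l_t - l_t^k)^2)^(1/2), and each squared regret is at most
  \<parallel>x_t - x_t^k\<parallel>^2/(2D)^2.  Choosing k = E(A, \<lambda>') with \<lambda>' \<le> \<lambda>, strong convexity gives an extra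
  -\<lambda>/2 \<parallel>x_t - x_t^k\<parallel>^2 per round, which absorbs the square root by AM-GM and leaves the
  additive term \<Gamma>^2 G^2 / (2\<lambda> ln|E|) on top of the regret R(A, \<lambda>') of the expert.\<close>

lemma ln_one_minus_ge:
  fixes x :: real assumes "0 \<le> x" "x \<le> 1/2"
  shows "- x - x\<^sup>2 \<le> ln (1 - x)"
proof -
  let ?h = "\<lambda>x::real. ln (1 - x) + x + x\<^sup>2"
  have "?h 0 \<le> ?h x"
  proof (rule DERIV_nonneg_imp_increasing_open[OF assms(1)])
    fix y :: real assume y: "0 < y" "y < x"
    have "DERIV ?h y :> (- 1 / (1 - y) + 1 + 2 * y)"
      using y assms by (auto intro!: derivative_eq_intros simp: field_simps)
    moreover have "- 1 / (1 - y) + 1 + 2 * y = y * (1 - 2*y) / (1 - y)"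
      using y assms by (simp add: field_simps power2_eq_square)
    moreover have "y * (1 - 2*y) / (1 - y) \<ge> 0"
      using y assms by (intro divide_nonneg_pos mult_nonneg_nonneg) auto
    ultimately show "\<exists>z. DERIV ?h y :> z \<and> z \<ge> 0" by auto
  next
    show "continuous_on {0..x} ?h" using assms by (intro continuous_intros) auto
  qed
  thus ?thesis by simp
qed

lemma ln_one_plus_ge:
  fixes z :: real assumes "-1/2 \<le> z" "z \<le> 1"
  shows "z - z\<^sup>2 \<le> ln (1 + z)"
proof (cases "z \<ge> 0")
  case True thus ?thesis using ln_one_plus_pos_lower_bound assms by auto
next
  case False
  have "- (-z) - (-z)\<^sup>2 \<le> ln (1 - (-z))" by (rule ln_one_minus_ge) (use False assms in auto)
  thus ?thesis by simp
qed

text \<open>From 1 + v \<le> e^v with v = u(1/a - 1), where u = a ln y, together with -u e^u \<le> 1/e.\<close>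

lemma powr_le_self_plus:
  fixes y a :: real assumes "y > 0" "0 < a" "a \<le> 1"
  shows "y powr a \<le> y + (1/a - 1) / exp 1"
proof -
  define u where "u = a * ln y"
  have ya: "y powr a = exp u" using assms by (simp add: powr_def u_def)
  have "y = exp u * exp (u * (1/a - 1))"
    using assms by (simp add: u_def field_simps flip: exp_add)
  moreover have "exp (u * (1/a - 1)) \<ge> 1 + u * (1/a - 1)" by simp
  ultimately have y: "y \<ge> exp u * (1 + u * (1/a - 1))" by (simp add: mult_left_mono)
  have "1 + (-u - 1) \<le> exp (-u - 1)" by (rule exp_ge_add_one_self)
  hence "- u \<le> exp (-u) / exp 1" by (simp add: exp_diff)
  hence "- u * exp u \<le> exp (-u) / exp 1 * exp u" by (rule mult_right_mono) simp
  hence ue: "- u * exp u \<le> 1 / exp 1" by (simp add: exp_minus field_simps)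
  have a: "1/a - 1 \<ge> 0" using assms by simp
  have "exp u \<le> y + (1/a - 1) * (- u * exp u)" using y by (simp add: algebra_simps)
  also have "\<dots> \<le> y + (1/a - 1) * (1 / exp 1)" using mult_left_mono[OF ue a] by simp
  finally show ?thesis using ya by simp
qed

lemma div_one_plus_le_telescope:
  fixes s x :: real assumes "0 \<le> s" "0 \<le> x" "x \<le> 1"
  shows "x / (1 + s) \<le> (1 / (1 + s) - 1 / (1 + (s + x))) + (ln (1 + (s + x)) - ln (1 + s))"
proof -
  have p: "1 + s > 0" "1 + s + x > 0" using assms by auto
  have "ln ((1 + s) / (1 + s + x)) \<le> (1 + s) / (1 + s + x) - 1"
    by (rule ln_le_minus_one) (use p in simp)
  hence l: "x / (1 + s + x) \<le> ln (1 + s + x) - ln (1 + s)" using p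
    by (simp add: ln_div field_simps)
  have "x / (1 + s) - x / (1 + s + x) = x * x / ((1 + s) * (1 + s + x))" using p
    by (simp add: field_simps)
  also have "\<dots> \<le> x / ((1 + s) * (1 + s + x))" using assms p
    by (intro divide_right_mono) (auto simp: mult_left_le)
  also have "\<dots> = 1 / (1 + s) - 1 / (1 + (s + x))" using p by (simp add: field_simps)
  finally show ?thesis using l by (simp add: add.assoc)
qed

lemma div_sqrt_one_plus_le_telescope:
  fixes s x :: real assumes "0 \<le> s" "0 \<le> x" "x \<le> 1"
  shows "x / sqrt (1 + s) \<le> 2 * (sqrt (s + x) - sqrt s)"
proof (cases "x = 0")
  case True thus ?thesis by simp
next
  case False
  hence xp: "x > 0" using assms by simp
  have q: "sqrt (s + x) + sqrt s > 0" using assms xp by (simp add: add_pos_nonneg)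
  have "(sqrt (s + x) - sqrt s) * (sqrt (s + x) + sqrt s) = x"
    using assms by (simp add: algebra_simps)
  hence d: "sqrt (s + x) - sqrt s = x / (sqrt (s + x) + sqrt s)"
    using q by (simp add: eq_divide_eq)
  have "sqrt (s + x) + sqrt s \<le> 2 * sqrt (1 + s)"
    using assms by (intro add_mono[of _ "sqrt (1+s)" _ "sqrt (1+s)", simplified] real_sqrt_le_mono) auto
  hence "x / (2 * sqrt (1 + s)) \<le> x / (sqrt (s + x) + sqrt s)"
    using xp q assms by (intro divide_left_mono) (auto intro!: mult_pos_pos)
  thus ?thesis using d by (simp add: field_simps)
qed

lemma mult_sqrt_minus_le:
  fixes c s lam :: real assumes "lam > 0" "s \<ge> 0"
  shows "c * sqrt s - lam / 2 * s \<le> c\<^sup>2 / (2 * lam)"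
proof -
  have "0 \<le> (c - lam * sqrt s)\<^sup>2" by simp
  hence "2 * lam * (c * sqrt s) \<le> c\<^sup>2 + lam\<^sup>2 * s"
    using assms by (simp add: power2_diff power_mult_distrib algebra_simps)
  thus ?thesis using assms by (simp add: field_simps power2_eq_square)
qed

subsection \<open>The learning rates of Adapt-ML-Prod\<close>

lemma ml_eta_pos: "ln (real n) > 0 \<Longrightarrow> S \<ge> 0 \<Longrightarrow> 0 < ml_eta n S"
  by (simp add: ml_eta_def)

lemma ml_eta_le_half: "ml_eta n S \<le> 1/2"
  by (simp add: ml_eta_def)

lemma ml_eta_le_sqrt: "ml_eta n S \<le> sqrt (ln (real n) / (1 + S))"
  by (simp add: ml_eta_def)

lemma ml_eta_antimono: "ln (real n) > 0 \<Longrightarrow> 0 \<le> S \<Longrightarrow> S \<le> S' \<Longrightarrow> ml_eta n S' \<le> ml_eta n S"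
  unfolding ml_eta_def by (intro min.mono order.refl real_sqrt_le_mono divide_left_mono) auto

lemma ml_eta_ratio_le:
  assumes L: "ln (real n) > 0" and S: "0 \<le> S" "S \<le> S'"
  shows "ml_eta n S / ml_eta n S' \<le> sqrt ((1 + S') / (1 + S))"
proof -
  define a where "a = sqrt (ln (real n) / (1 + S))"
  define b where "b = sqrt (ln (real n) / (1 + S'))"
  have "(ln (real n) / (1 + S)) / (ln (real n) / (1 + S')) = (1 + S') / (1 + S)"
    using L S by (simp add: divide_simps)
  hence ab: "a / b = sqrt ((1 + S') / (1 + S))" unfolding a_def b_def
    by (simp add: real_sqrt_divide[symmetric])
  have b: "b > 0" using L S by (simp add: b_def)
  show ?thesis
  proof (cases "b \<ge> 1/2")
    case True
    have "a \<ge> b" using L S unfolding a_def b_def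
      by (intro real_sqrt_le_mono divide_left_mono) auto
    have e: "ml_eta n S = min (1/2) a" "ml_eta n S' = min (1/2) b"
      by (simp_all add: ml_eta_def a_def b_def)
    have h: "ml_eta n S = 1/2" "ml_eta n S' = 1/2" unfolding e using True \<open>a \<ge> b\<close> by auto
    show ?thesis unfolding h using S by simp
  next
    case False
    hence "ml_eta n S' = b" by (simp add: ml_eta_def b_def)
    moreover have "ml_eta n S \<le> a" by (simp add: ml_eta_def a_def)
    ultimately have "ml_eta n S / ml_eta n S' \<le> a / b" using b by (simp add: divide_right_mono)
    thus ?thesis using ab by simp
  qed
qed

lemma ml_eta_ratio_minus_one_le:
  assumes "ln (real n) > 0" "0 \<le> s" "0 \<le> x"
  shows "ml_eta n s / ml_eta n (s + x) - 1 \<le> x / (1 + s) / 2"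
proof -
  define u where "u = (1 + (s + x)) / (1 + s)"
  have "ml_eta n s / ml_eta n (s + x) \<le> sqrt u" unfolding u_def
    by (rule ml_eta_ratio_le) (use assms in auto)
  also have "sqrt u \<le> (u + 1) / 2"
  proof -
    have "0 \<le> (sqrt u - 1)\<^sup>2" by simp
    moreover have "u \<ge> 0" using assms by (simp add: u_def)
    ultimately show ?thesis by (simp add: power2_diff)
  qed
  finally have "ml_eta n s / ml_eta n (s + x) - 1 \<le> (u - 1) / 2" by simp
  also have "u - 1 = x / (1 + s)" using assms by (simp add: u_def field_simps)
  finally show ?thesis .
qed

lemma inverse_ml_eta_le:
  assumes L: "ln (real n) > 0" and S: "0 \<le> S"
  shows "1 / ml_eta n S \<le> 2 + sqrt ((1 + S) / ln (real n))"
proof -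
  define a where "a = sqrt (ln (real n) / (1 + S))"
  have ia: "1 / a = sqrt ((1 + S) / ln (real n))" using L S
    by (simp add: a_def real_sqrt_divide)
  show ?thesis
  proof (cases "a \<le> 1/2")
    case True
    hence "ml_eta n S = a" by (simp add: ml_eta_def a_def)
    thus ?thesis using ia by simp
  next
    case False
    hence e: "ml_eta n S = 1/2" by (simp add: ml_eta_def a_def)
    show ?thesis unfolding e using S L by simp
  qed
qed

lemma ml_prob_nonneg:
  assumes "\<forall>j\<in>E. w j > 0" "\<forall>j. S j \<ge> 0" "ln (real (card E)) > 0" "i \<in> E"
  shows "0 \<le> ml_prob E w S i"
proof -
  have "0 \<le> ml_eta (card E) (S j) * w j" if "j \<in> E" for j
    using assms that ml_eta_pos[OF assms(3)] by (simp add: less_imp_le)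
  thus ?thesis unfolding ml_prob_def using assms(4) by (intro divide_nonneg_nonneg sum_nonneg) auto
qed

lemma sum_ml_prob:
  assumes "finite E" "\<forall>j\<in>E. w j > 0" "\<forall>j. S j \<ge> 0" "2 \<le> card E"
  shows "(\<Sum>i\<in>E. ml_prob E w S i) = 1"
proof -
  have Ln: "ln (real (card E)) > 0" using assms(4) by simp
  define Z where "Z = (\<Sum>j\<in>E. ml_eta (card E) (S j) * w j)"
  have "Z > 0" unfolding Z_def using assms ml_eta_pos[OF Ln]
    by (intro sum_pos) (auto intro: mult_pos_pos)
  thus ?thesis by (simp add: ml_prob_def sum_divide_distrib[symmetric] Z_def[symmetric])
qed

subsection \<open>Adapt-ML-Prod against an adaptive adversary\<close>

text \<open>The loss vector of round t+1 may depend on the current state (w_t, S_t); this is how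
  USC feeds losses that are measured at its own combined point.\<close>

primrec ml_prod_state ::
  "'e set \<Rightarrow> (nat \<Rightarrow> ('e \<Rightarrow> real) \<Rightarrow> ('e \<Rightarrow> real) \<Rightarrow> 'e \<Rightarrow> real) \<Rightarrow> nat
    \<Rightarrow> ('e \<Rightarrow> real) \<times> ('e \<Rightarrow> real)" where
  "ml_prod_state E loss 0 = ((\<lambda>i. 1 / real (card E)), (\<lambda>i. 0))"
| "ml_prod_state E loss (Suc t) =
     (let (w, S) = ml_prod_state E loss t;
          n = card E;
          li = loss t w S;
          l = (\<Sum>i\<in>E. ml_prob E w S i * li i);
          S' = (\<lambda>i. S i + (l - li i)\<^sup>2);
          w' = (\<lambda>i. (w i * (1 + ml_eta n (S i) * (l - li i)))
                       powr (ml_eta n (S' i) / ml_eta n (S i)))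
      in (w', S'))"

locale adapt_ml_prod =
  fixes E :: "'e set" and loss :: "nat \<Rightarrow> ('e \<Rightarrow> real) \<Rightarrow> ('e \<Rightarrow> real) \<Rightarrow> 'e \<Rightarrow> real"
  assumes finite_E: "finite E" and card_E: "2 \<le> card E"
    and loss_unit: "\<And>t w S i. \<forall>j\<in>E. w j > 0 \<Longrightarrow> \<forall>j. S j \<ge> 0 \<Longrightarrow> i \<in> E
       \<Longrightarrow> 0 \<le> loss t w S i \<and> loss t w S i \<le> 1"
begin

definition w :: "nat \<Rightarrow> 'e \<Rightarrow> real" where "w t = fst (ml_prod_state E loss t)"
definition S :: "nat \<Rightarrow> 'e \<Rightarrow> real" where "S t = snd (ml_prod_state E loss t)"
definition L :: "nat \<Rightarrow> 'e \<Rightarrow> real" where "L t = loss t (w t) (S t)"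
definition lb :: "nat \<Rightarrow> real" where "lb t = (\<Sum>j\<in>E. ml_prob E (w t) (S t) j * L t j)"

abbreviation "n \<equiv> card E"
abbreviation "eta t i \<equiv> ml_eta n (S t i)"

lemma w_0: "w 0 i = 1 / real n" and S_0: "S 0 i = 0"
  by (simp_all add: w_def S_def)

lemma S_Suc: "S (Suc t) i = S t i + (lb t - L t i)\<^sup>2"
  by (simp add: S_def w_def L_def lb_def Let_def case_prod_unfold)

lemma w_Suc: "w (Suc t) i = (w t i * (1 + eta t i * (lb t - L t i))) powr (eta (Suc t) i / eta t i)"
  by (simp add: S_def w_def L_def lb_def Let_def case_prod_unfold)

lemma ln_n_pos: "ln (real n) > 0"
  using card_E by simp

lemma S_nonneg: "0 \<le> S t i"
  by (induction t) (auto simp: S_0 S_Suc)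

lemma S_eq_sum: "S t i = (\<Sum>s<t. (lb s - L s i)\<^sup>2)"
  by (induction t) (simp_all add: S_0 S_Suc)

lemma eta_pos: "0 < eta t i"
  using ml_eta_pos[OF ln_n_pos S_nonneg] .

lemma prob_nonneg: "\<forall>j\<in>E. w t j > 0 \<Longrightarrow> i \<in> E \<Longrightarrow> 0 \<le> ml_prob E (w t) (S t) i"
  by (rule ml_prob_nonneg) (simp_all add: S_nonneg ln_n_pos)

lemma sum_prob: "\<forall>j\<in>E. w t j > 0 \<Longrightarrow> (\<Sum>i\<in>E. ml_prob E (w t) (S t) i) = 1"
  by (rule sum_ml_prob) (simp_all add: finite_E card_E S_nonneg)

lemma L_unit: "\<forall>j\<in>E. w t j > 0 \<Longrightarrow> i \<in> E \<Longrightarrow> 0 \<le> L t i \<and> L t i \<le> 1"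
  unfolding L_def by (rule loss_unit) (simp_all add: S_nonneg)

lemma lb_unit:
  assumes wp: "\<forall>j\<in>E. w t j > 0"
  shows "0 \<le> lb t \<and> lb t \<le> 1"
proof
  note L = L_unit[OF wp]
  show "0 \<le> lb t" unfolding lb_def using L prob_nonneg[OF wp]
    by (intro sum_nonneg mult_nonneg_nonneg) auto
  have "lb t \<le> (\<Sum>j\<in>E. ml_prob E (w t) (S t) j * 1)" unfolding lb_def using L prob_nonneg[OF wp]
    by (intro sum_mono mult_left_mono) auto
  thus "lb t \<le> 1" using sum_prob[OF wp] by simp
qed

lemma eta_regret_abs_le_if_pos:
  assumes "\<forall>j\<in>E. w t j > 0" "i \<in> E"
  shows "\<bar>eta t i * (lb t - L t i)\<bar> \<le> 1/2"
proof -
  have r: "\<bar>lb t - L t i\<bar> \<le> 1"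
    using lb_unit[OF assms(1)] L_unit[OF assms] by auto
  have "\<bar>eta t i * (lb t - L t i)\<bar> \<le> 1/2 * 1"
    unfolding abs_mult using eta_pos[of t i] ml_eta_le_half[of n "S t i"] r
    by (intro mult_mono) auto
  thus ?thesis by simp
qed

lemma w_pos: "\<forall>j\<in>E. w t j > 0"
proof (induction t)
  case 0 thus ?case using card_E by (simp add: w_0)
next
  case (Suc t)
  show ?case
  proof
    fix i assume i: "i \<in> E"
    have "0 < 1 + eta t i * (lb t - L t i)"
      using eta_regret_abs_le_if_pos[OF Suc.IH i] by (simp add: abs_le_iff)
    moreover have "0 < w t i" using Suc.IH i by simp
    ultimately show "0 < w (Suc t) i" unfolding w_Suc by simp
  qed
qed

lemma eta_regret_abs_le: "i \<in> E \<Longrightarrow> \<bar>eta t i * (lb t - L t i)\<bar> \<le> 1/2"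
  using eta_regret_abs_le_if_pos[OF w_pos] .

lemma regret_abs_le_one:
  assumes "i \<in> E" shows "\<bar>lb t - L t i\<bar> \<le> 1"
proof -
  have "0 \<le> lb t \<and> lb t \<le> 1" "0 \<le> L t i \<and> L t i \<le> 1"
    by (rule lb_unit[OF w_pos], rule L_unit[OF w_pos assms])
  thus ?thesis by auto
qed

lemma sq_regret_le_one: "i \<in> E \<Longrightarrow> (lb t - L t i)\<^sup>2 \<le> 1"
  using regret_abs_le_one abs_square_le_1 by blast

lemma S_le: "i \<in> E \<Longrightarrow> S t i \<le> real t"
proof (induction t)
  case (Suc t) thus ?case using sq_regret_le_one[OF Suc.prems, of t] by (simp add: S_Suc)
qed (simp add: S_0)

text \<open>The probabilities are proportional to eta * w, which makes the mixture loss lb t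
  exactly cancel the first-order term of the weight update.\<close>

lemma weighted_regret_sum_zero: "(\<Sum>i\<in>E. eta t i * w t i * (lb t - L t i)) = 0"
proof -
  define Z where "Z = (\<Sum>j\<in>E. eta t j * w t j)"
  have Z: "Z > 0" unfolding Z_def using finite_E card_E w_pos eta_pos
    by (intro sum_pos) (auto intro: mult_pos_pos)
  have "lb t = (\<Sum>j\<in>E. eta t j * w t j * L t j) / Z"
    unfolding lb_def ml_prob_def Z_def[symmetric] by (simp add: sum_divide_distrib)
  hence "lb t * Z = (\<Sum>j\<in>E. eta t j * w t j * L t j)" using Z by simp
  moreover have "(\<Sum>i\<in>E. eta t i * w t i * (lb t - L t i))
      = (\<Sum>i\<in>E. lb t * (eta t i * w t i) - eta t i * w t i * L t i)"
    by (rule sum.cong) (simp_all add: right_diff_distrib)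
  moreover have "\<dots> = lb t * Z - (\<Sum>j\<in>E. eta t j * w t j * L t j)"
    by (simp add: sum_subtractf sum_distrib_left Z_def)
  ultimately show ?thesis by linarith
qed

lemma total_weight_Suc_le:
  "(\<Sum>i\<in>E. w (Suc t) i) \<le> (\<Sum>i\<in>E. w t i) + (\<Sum>i\<in>E. (eta t i / eta (Suc t) i - 1) / exp 1)"
proof -
  have each: "w (Suc t) i \<le> (w t i + eta t i * w t i * (lb t - L t i))
      + (eta t i / eta (Suc t) i - 1) / exp 1" if i: "i \<in> E" for i
  proof -
    define y where "y = w t i * (1 + eta t i * (lb t - L t i))"
    have "\<bar>eta t i * (lb t - L t i)\<bar> \<le> 1/2" using eta_regret_abs_le[OF i] .
    hence "0 < 1 + eta t i * (lb t - L t i)" by (simp add: abs_le_iff)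
    hence y: "y > 0" using w_pos i by (simp add: y_def)
    have "S t i \<le> S (Suc t) i" by (simp add: S_Suc)
    hence a1: "eta (Suc t) i / eta t i \<le> 1"
      using eta_pos[of t i] ml_eta_antimono[OF ln_n_pos S_nonneg] by simp
    have a0: "0 < eta (Suc t) i / eta t i" using eta_pos[of t i] eta_pos[of "Suc t" i] by simp
    have "w (Suc t) i = y powr (eta (Suc t) i / eta t i)" by (simp add: w_Suc y_def)
    also have "\<dots> \<le> y + (1 / (eta (Suc t) i / eta t i) - 1) / exp 1"
      by (rule powr_le_self_plus[OF y a0 a1])
    also have "\<dots> = (w t i + eta t i * w t i * (lb t - L t i)) + (eta t i / eta (Suc t) i - 1) / exp 1"
      by (simp add: y_def algebra_simps)
    finally show ?thesis .
  qed
  have "(\<Sum>i\<in>E. w (Suc t) i) \<le> (\<Sum>i\<in>E. (w t i + eta t i * w t i * (lb t - L t i))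
      + (eta t i / eta (Suc t) i - 1) / exp 1)"
    by (rule sum_mono) (rule each)
  thus ?thesis using weighted_regret_sum_zero by (simp add: sum.distrib)
qed

lemma eta_ratio_sum_le:
  assumes i: "i \<in> E"
  shows "(\<Sum>s<t. eta s i / eta (Suc s) i - 1) \<le> (1 + ln (real t + 1)) / 2"
proof -
  define f where "f s = - 1 / (1 + S s i) + ln (1 + S s i)" for s
  have "(\<Sum>s<t. eta s i / eta (Suc s) i - 1) \<le> (\<Sum>s<t. (f (Suc s) - f s) / 2)"
  proof (rule sum_mono)
    fix s
    have x: "0 \<le> (lb s - L s i)\<^sup>2" "(lb s - L s i)\<^sup>2 \<le> 1" using sq_regret_le_one[OF i] by auto
    have "eta s i / eta (Suc s) i - 1 \<le> (lb s - L s i)\<^sup>2 / (1 + S s i) / 2"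
      unfolding S_Suc by (rule ml_eta_ratio_minus_one_le[OF ln_n_pos S_nonneg x(1)])
    also have "\<dots> \<le> (f (Suc s) - f s) / 2"
    proof (rule divide_right_mono)
      show "(lb s - L s i)\<^sup>2 / (1 + S s i) \<le> f (Suc s) - f s"
        using div_one_plus_le_telescope[OF S_nonneg x, of s i] by (simp add: f_def S_Suc)
    qed simp
    finally show "eta s i / eta (Suc s) i - 1 \<le> (f (Suc s) - f s) / 2" .
  qed
  also have "\<dots> = (f t - f 0) / 2"
    by (simp add: sum_divide_distrib[symmetric] sum_lessThan_telescope)
  also have "\<dots> \<le> (1 + ln (real t + 1)) / 2"
  proof -
    have "0 \<le> 1 / (1 + S t i)" "ln (1 + S t i) \<le> ln (real t + 1)"
      using S_nonneg[of t i] S_le[OF i, of t] by simp_all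
    moreover have "f t - f 0 = ln (1 + S t i) - 1 / (1 + S t i) + 1" by (simp add: f_def S_0)
    ultimately have "f t - f 0 \<le> 1 + ln (real t + 1)" by linarith
    thus ?thesis by (simp add: divide_right_mono)
  qed
  finally show ?thesis .
qed

definition total_weight_bound :: "nat \<Rightarrow> real" where
  "total_weight_bound t = 1 + real n / (2 * exp 1) * (1 + ln (real t + 1))"

lemma total_weight_bound_ge_1: "total_weight_bound t \<ge> 1"
  unfolding total_weight_bound_def by (intro add_increasing2 mult_nonneg_nonneg) auto

lemma total_weight_le: "(\<Sum>i\<in>E. w t i) \<le> total_weight_bound t"
proof -
  have "(\<Sum>i\<in>E. w t i) \<le> 1 + (\<Sum>s<t. \<Sum>i\<in>E. (eta s i / eta (Suc s) i - 1) / exp 1)"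
  proof (induction t)
    case 0 show ?case using card_E by (simp add: w_0)
  next
    case (Suc t) thus ?case using total_weight_Suc_le[of t] by simp
  qed
  also have "(\<Sum>s<t. \<Sum>i\<in>E. (eta s i / eta (Suc s) i - 1) / exp 1)
      = (\<Sum>i\<in>E. \<Sum>s<t. eta s i / eta (Suc s) i - 1) / exp 1"
    by (simp add: sum.swap[of _ "{..<t}"] sum_divide_distrib)
  also have "\<dots> \<le> (\<Sum>i\<in>E. (1 + ln (real t + 1)) / 2) / exp 1"
    by (intro divide_right_mono sum_mono eta_ratio_sum_le) auto
  finally show ?thesis unfolding total_weight_bound_def by simp
qed

lemma ln_weight_div_eta_ge:
  assumes i: "i \<in> E"
  shows "- ln (real n) / eta 0 i + (\<Sum>s<t. (lb s - L s i) - eta s i * (lb s - L s i)\<^sup>2)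
           \<le> ln (w t i) / eta t i"
proof (induction t)
  case 0 show ?case using card_E by (simp add: w_0 ln_div)
next
  case (Suc t)
  define r where "r = lb t - L t i"
  define e where "e = eta t i"
  have z: "\<bar>e * r\<bar> \<le> 1/2" using eta_regret_abs_le[OF i] by (simp add: r_def e_def)
  have ep: "0 < e" "0 < eta (Suc t) i" using eta_pos by (auto simp: e_def)
  have "0 < 1 + e * r" using z by (simp add: abs_le_iff)
  moreover have "0 < w t i" using w_pos i by simp
  ultimately have "ln (w (Suc t) i) = eta (Suc t) i / e * (ln (w t i) + ln (1 + e * r))"
    by (simp add: w_Suc r_def e_def ln_mult)
  hence step: "ln (w (Suc t) i) / eta (Suc t) i = ln (w t i) / e + ln (1 + e * r) / e"
    using ep by (simp add: field_simps)
  have "e * r - (e * r)\<^sup>2 \<le> ln (1 + e * r)"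
    by (rule ln_one_plus_ge) (use z in \<open>auto simp: abs_le_iff\<close>)
  hence "r - e * r\<^sup>2 \<le> ln (1 + e * r) / e"
    using ep by (simp add: field_simps power2_eq_square)
  thus ?case using Suc.IH step by (simp add: r_def e_def)
qed

lemma eta_weighted_sq_regret_le:
  assumes i: "i \<in> E"
  shows "(\<Sum>s<t. eta s i * (lb s - L s i)\<^sup>2) \<le> 2 * sqrt (ln (real n)) * sqrt (S t i)"
proof -
  have "(\<Sum>s<t. eta s i * (lb s - L s i)\<^sup>2)
      \<le> (\<Sum>s<t. sqrt (ln (real n)) * (2 * (sqrt (S (Suc s) i) - sqrt (S s i))))"
  proof (rule sum_mono)
    fix s
    have x: "0 \<le> (lb s - L s i)\<^sup>2" "(lb s - L s i)\<^sup>2 \<le> 1" using sq_regret_le_one[OF i] by auto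
    have "eta s i * (lb s - L s i)\<^sup>2 \<le> sqrt (ln (real n) / (1 + S s i)) * (lb s - L s i)\<^sup>2"
      by (intro mult_right_mono ml_eta_le_sqrt) simp
    also have "\<dots> = sqrt (ln (real n)) * ((lb s - L s i)\<^sup>2 / sqrt (1 + S s i))"
      by (simp add: real_sqrt_divide)
    also have "\<dots> \<le> sqrt (ln (real n)) * (2 * (sqrt (S (Suc s) i) - sqrt (S s i)))"
      using div_sqrt_one_plus_le_telescope[OF S_nonneg x, of s i] ln_n_pos
      by (intro mult_left_mono) (auto simp: S_Suc)
    finally show "eta s i * (lb s - L s i)\<^sup>2
        \<le> sqrt (ln (real n)) * (2 * (sqrt (S (Suc s) i) - sqrt (S s i)))" .
  qed
  also have "\<dots> = 2 * sqrt (ln (real n)) * (\<Sum>s<t. sqrt (S (Suc s) i) - sqrt (S s i))"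
    by (simp add: sum_distrib_left algebra_simps)
  also have "\<dots> = 2 * sqrt (ln (real n)) * sqrt (S t i)"
    using sum_lessThan_telescope[of "\<lambda>s. sqrt (S s i)" t] by (simp add: S_0)
  finally show ?thesis .
qed

lemma ln_weight_div_eta_le:
  assumes k: "k \<in> E"
  shows "ln (w t k) / eta t k
    \<le> ln (total_weight_bound t) * (2 + (1 + sqrt (S t k)) / sqrt (ln (real n)))"
proof -
  define lB where "lB = ln (total_weight_bound t)"
  have lB: "lB \<ge> 0" using total_weight_bound_ge_1 by (simp add: lB_def)
  have "w t k \<le> sum (w t) E"
    by (rule member_le_sum[OF k]) (use w_pos finite_E in \<open>auto intro: less_imp_le\<close>)
  hence "w t k \<le> total_weight_bound t" using total_weight_le[of t] by simp
  moreover have "0 < w t k" using w_pos k by simp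
  ultimately have "ln (w t k) \<le> lB" unfolding lB_def by simp
  hence "ln (w t k) / eta t k \<le> lB * (1 / eta t k)"
    using eta_pos[of t k] by (simp add: divide_right_mono)
  also have "\<dots> \<le> lB * (2 + sqrt ((1 + S t k) / ln (real n)))"
    by (intro mult_left_mono inverse_ml_eta_le[OF ln_n_pos S_nonneg] lB)
  also have "\<dots> \<le> lB * (2 + (1 + sqrt (S t k)) / sqrt (ln (real n)))"
  proof -
    have "sqrt (1 + S t k) \<le> sqrt 1 + sqrt (S t k)"
      using S_nonneg[of t k] by (intro sqrt_add_le_add_sqrt) auto
    thus ?thesis using lB ln_n_pos
      by (intro mult_left_mono add_left_mono) (auto simp: real_sqrt_divide divide_right_mono)
  qed
  finally show ?thesis unfolding lB_def .
qed

text \<open>ln w_T^k / eta_T^k is squeezed between the lower bound accumulated through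
  ln (1 + z) \<ge> z - z^2 and the upper bound coming from the total weight.\<close>

theorem regret_le_second_order:
  assumes k: "k \<in> E"
  shows "(\<Sum>s<t. lb s - L s k) \<le> usc_Gamma n t * (2 + 1 / sqrt (ln (real n)))
           + usc_Gamma n t / sqrt (ln (real n)) * sqrt (\<Sum>s<t. (lb s - L s k)\<^sup>2)"
proof -
  define q where "q = sqrt (ln (real n))"
  define lB where "lB = ln (total_weight_bound t)"
  define sS where "sS = sqrt (S t k)"
  have q: "q > 0" using ln_n_pos by (simp add: q_def)
  have Lq: "ln (real n) = q\<^sup>2" using ln_n_pos by (simp add: q_def)
  have sS: "sS \<ge> 0" using S_nonneg[of t k] by (simp add: sS_def)
  have Gamma: "usc_Gamma n t = 3 * q\<^sup>2 + lB"
    by (simp add: usc_Gamma_def lB_def total_weight_bound_def Lq)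
  have init: "ln (real n) / eta 0 k \<le> q\<^sup>2 * (2 + 1 / q)"
  proof -
    have "ln (real n) / eta 0 k = ln (real n) * (1 / eta 0 k)" by simp
    also have "\<dots> \<le> ln (real n) * (2 + sqrt ((1 + S 0 k) / ln (real n)))"
      using ln_n_pos by (intro mult_left_mono inverse_ml_eta_le[OF ln_n_pos S_nonneg]) auto
    also have "\<dots> = q\<^sup>2 * (2 + 1 / q)" using q by (simp add: S_0 Lq real_sqrt_divide)
    finally show ?thesis .
  qed
  have "(\<Sum>s<t. lb s - L s k) \<le> lB * (2 + (1 + sS) / q) + q\<^sup>2 * (2 + 1 / q) + 2 * q * sS"
    using ln_weight_div_eta_ge[OF k, of t] ln_weight_div_eta_le[OF k, of t] init
      eta_weighted_sq_regret_le[OF k, of t]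
    by (simp add: sum_subtractf q_def lB_def sS_def)
  also have "\<dots> \<le> (3 * q\<^sup>2 + lB) * (2 + 1 / q) + (3 * q\<^sup>2 + lB) / q * sS"
    using q sS by (simp add: field_simps power2_eq_square)
  finally show ?thesis by (simp add: Gamma q_def sS_def S_eq_sum)
qed

end

subsection \<open>The expert set and the surrogate losses of USC\<close>

lemma Pgrid_eq: "Pgrid T = (\<lambda>k. 2 ^ k / real T) ` {..nat \<lceil>log 2 (real T)\<rceil>}"
  unfolding Pgrid_def by auto

lemma finite_Pgrid: "finite (Pgrid T)"
  unfolding Pgrid_eq by simp

lemma Pgrid_pos: "T > 0 \<Longrightarrow> l \<in> Pgrid T \<Longrightarrow> l > 0"
  unfolding Pgrid_def by auto

text \<open>Take k = \<lfloor>log_2 (\<lambda>T)\<rfloor>; the constraint \<lambda> \<le> 1 keeps k \<le> \<lceil>log_2 T\<rceil>.\<close>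

lemma Pgrid_bracket:
  assumes "T \<ge> 2" "1 / real T \<le> lam" "lam \<le> 1"
  shows "\<exists>lh\<in>Pgrid T. lh \<le> lam \<and> lam \<le> 2 * lh"
proof -
  have T0: "real T > 0" using assms by simp
  have lt: "lam * real T \<ge> 1" using assms T0 by (simp add: field_simps)
  define m where "m = \<lfloor>log 2 (lam * real T)\<rfloor>"
  have m0: "m \<ge> 0" unfolding m_def using lt by simp
  define k where "k = nat m"
  have km: "real k = real_of_int m" using m0 by (simp add: k_def)
  have "2 powr real k \<le> 2 powr log 2 (lam * real T)"
    unfolding km m_def by (intro powr_mono) auto
  hence k1: "2 ^ k \<le> lam * real T" using lt by (simp add: powr_realpow)
  have "2 powr log 2 (lam * real T) < 2 powr (real k + 1)"
    unfolding km m_def by (intro powr_less_mono) auto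
  hence k2: "lam * real T < 2 * 2 ^ k" using lt by (simp add: powr_add powr_realpow)
  have "log 2 (lam * real T) \<le> log 2 (real T)" using lt assms T0 by simp
  hence "k \<le> nat \<lceil>log 2 (real T)\<rceil>" unfolding k_def m_def by linarith
  hence "2 ^ k / real T \<in> Pgrid T" unfolding Pgrid_def by blast
  moreover have "2 ^ k / real T \<le> lam" "lam \<le> 2 * (2 ^ k / real T)"
    using k1 k2 T0 by (simp_all add: field_simps)
  ultimately show ?thesis by blast
qed

lemma finite_usc_experts:
  assumes "finite Astr" "finite Aexp" "finite Acon"
  shows "finite (usc_experts Astr Aexp Acon T)"
proof -
  have "usc_experts Astr Aexp Acon T \<subseteq> (\<lambda>(A, l). EStr A l) ` (Astr \<times> Pgrid T)
      \<union> (\<lambda>(A, l). EExp A l) ` (Aexp \<times> Pgrid T) \<union> ECon ` Acon"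
    unfolding usc_experts_def by auto
  thus ?thesis using assms finite_Pgrid by (auto intro: finite_subset)
qed

lemma card_usc_experts_ge_2:
  assumes "finite Astr" "finite Aexp" "finite Acon" "Astr \<noteq> {}" "T \<ge> 2"
  shows "2 \<le> card (usc_experts Astr Aexp Acon T)"
proof -
  obtain A where A: "A \<in> Astr" using assms by auto
  have "log 2 (real T) \<ge> 1" using assms by simp
  hence "1 \<le> nat \<lceil>log 2 (real T)\<rceil>" by linarith
  hence "2 ^ 1 / real T \<in> Pgrid T" unfolding Pgrid_def by blast
  moreover have "2 ^ 0 / real T \<in> Pgrid T" unfolding Pgrid_def by blast
  ultimately have "1 / real T \<in> Pgrid T" "2 / real T \<in> Pgrid T" by simp_all
  hence sub: "{EStr A (1 / real T), EStr A (2 / real T)} \<subseteq> usc_experts Astr Aexp Acon T"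
    using A unfolding usc_experts_def by auto
  have "card {EStr A (1 / real T), EStr A (2 / real T)} = 2" using assms by simp
  thus ?thesis using card_mono[OF finite_usc_experts[OF assms(1-3)] sub] by simp
qed

lemma expert_out_in:
  assumes "i \<in> usc_experts Astr Aexp Acon T" "T > 0" "1 \<le> t"
    "\<forall>A\<in>Astr. \<forall>l>0. is_online_alg X (A l)"
    "\<forall>A\<in>Aexp. \<forall>a>0. is_online_alg X (A a)"
    "\<forall>A\<in>Acon. is_online_alg X A"
  shows "expert_out i F t \<in> X"
  using assms Pgrid_pos[OF assms(2)] unfolding usc_experts_def is_online_alg_def by auto

lemma usc_Gamma_nonneg:
  assumes "2 \<le> n" shows "0 \<le> usc_Gamma n T"
proof -
  have "1 \<le> 1 + real n / (2 * exp 1) * (1 + ln (real T + 1))"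
    by (intro add_increasing2 mult_nonneg_nonneg) auto
  thus ?thesis using assms unfolding usc_Gamma_def by (intro add_nonneg_nonneg) auto
qed

lemma usc_loss_unit:
  fixes gr y xb :: "'a::real_inner"
  assumes "norm gr \<le> G" "dist y xb \<le> D" "G > 0" "D > 0"
  shows "0 \<le> usc_loss G D xb gr y \<and> usc_loss G D xb gr y \<le> 1"
proof -
  have "\<bar>gr \<bullet> (y - xb)\<bar> \<le> norm gr * norm (y - xb)" by (rule Cauchy_Schwarz_ineq2)
  also have "\<dots> \<le> G * D" using assms by (intro mult_mono) (auto simp: dist_norm)
  finally have h: "\<bar>gr \<bullet> (y - xb)\<bar> \<le> G * D" .
  have "2 * G * D > 0" using assms by simp
  thus ?thesis unfolding usc_loss_def using h
    by (auto simp: divide_le_eq_1 abs_le_iff mult.commute intro!: divide_nonneg_pos)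
qed

lemma sum_usc_loss:
  fixes y :: "'e \<Rightarrow> 'a::real_inner"
  assumes "finite E" "(\<Sum>j\<in>E. p j) = 1"
  shows "(\<Sum>j\<in>E. p j * usc_loss G D xb gr (y j)) = usc_loss G D xb gr (\<Sum>j\<in>E. p j *\<^sub>R y j)"
proof -
  have "(\<Sum>j\<in>E. p j * usc_loss G D xb gr (y j))
      = (\<Sum>j\<in>E. p j * (gr \<bullet> y j) + p j * (G * D - gr \<bullet> xb)) / (2 * G * D)"
    unfolding usc_loss_def sum_divide_distrib
    by (intro sum.cong refl) (simp add: inner_diff_right algebra_simps)
  also have "\<dots> = ((\<Sum>j\<in>E. p j * (gr \<bullet> y j)) + (\<Sum>j\<in>E. p j) * (G * D - gr \<bullet> xb)) / (2 * G * D)"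
    by (simp add: sum.distrib sum_distrib_right)
  also have "\<dots> = usc_loss G D xb gr (\<Sum>j\<in>E. p j *\<^sub>R y j)"
    unfolding usc_loss_def using assms by (simp add: inner_diff_right inner_sum_right)
  finally show ?thesis .
qed

lemma usc_loss_diff:
  "G * D \<noteq> 0 \<Longrightarrow> usc_loss G D xb gr x - usc_loss G D xb gr y = gr \<bullet> (x - y) / (2 * G * D)"
  unfolding usc_loss_def by (simp add: inner_diff_right diff_divide_distrib[symmetric])

lemma strongly_convex_grad_mono:
  assumes "strongly_convex_grad X f g lam" "lam' \<le> lam"
  shows "strongly_convex_grad X f g lam'"
  unfolding strongly_convex_grad_def
proof (intro ballI)
  fix x y assume xy: "x \<in> X" "y \<in> X"
  have "lam' / 2 * (norm (y - x))\<^sup>2 \<le> lam / 2 * (norm (y - x))\<^sup>2"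
    using assms(2) by (intro mult_right_mono) auto
  thus "f x + g x \<bullet> (y - x) + lam' / 2 * (norm (y - x))\<^sup>2 \<le> f y"
    using assms(1) xy unfolding strongly_convex_grad_def by fastforce
qed

lemma regret_diff:
  "regret X T F x - regret X T F y = (\<Sum>t<T. F (Suc t) (x (Suc t)) - F (Suc t) (y (Suc t)))"
  unfolding regret_def by (simp add: sum.atLeast1_atMost_eq[simplified] sum_subtractf)

subsection \<open>A run of USC\<close>

locale usc_run =
  fixes X :: "'a::euclidean_space set" and G D :: real and T :: nat
    and F :: "'a fseq" and gF :: "nat \<Rightarrow> 'a \<Rightarrow> 'a"
    and Astr Aexp :: "'a param_alg set" and Acon :: "'a online_alg set" and xb :: 'a
  assumes T_ge_2: "T \<ge> 2"
    and convex_X: "convex X" and diameter: "\<forall>x\<in>X. \<forall>y\<in>X. dist x y \<le> D"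
    and G_pos: "G > 0" and D_pos: "D > 0"
    and grad_le: "\<And>t x. t \<in> {1..T} \<Longrightarrow> x \<in> X \<Longrightarrow> norm (gF t x) \<le> G"
    and finite_algs: "finite Astr" "Astr \<noteq> {}" "finite Aexp" "finite Acon"
    and online_algs: "\<forall>A\<in>Astr. \<forall>l>0. is_online_alg X (A l)"
      "\<forall>A\<in>Aexp. \<forall>a>0. is_online_alg X (A a)" "\<forall>A\<in>Acon. is_online_alg X A"
    and xb_in_X: "xb \<in> X"
begin

definition experts :: "'a expert set" where "experts = usc_experts Astr Aexp Acon T"

definition out :: "'a expert \<Rightarrow> nat \<Rightarrow> 'a" where "out i = expert_out i F"

text \<open>The losses beyond the horizon never influence the outputs up to round T; setting them
  to 0 keeps every loss in [0, 1].\<close>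

definition round_loss :: "nat \<Rightarrow> ('a expert \<Rightarrow> real) \<Rightarrow> ('a expert \<Rightarrow> real) \<Rightarrow> 'a expert \<Rightarrow> real"
  where "round_loss t w S = (if t < T
     then (\<lambda>i. usc_loss G D xb (gF (Suc t) (ml_combine experts out w S (Suc t))) (out i (Suc t)))
     else (\<lambda>i. 0))"

lemma finite_experts: "finite experts"
  unfolding experts_def using finite_usc_experts finite_algs by blast

lemma card_experts: "2 \<le> card experts"
  unfolding experts_def using card_usc_experts_ge_2 finite_algs T_ge_2 by blast

lemma out_in_X: "i \<in> experts \<Longrightarrow> 1 \<le> t \<Longrightarrow> out i t \<in> X"
  unfolding out_def experts_def by (rule expert_out_in[OF _ _ _ online_algs]) (use T_ge_2 in auto)

lemma combine_in_X:
  assumes "\<forall>j\<in>experts. w j > 0" "\<forall>j. S j \<ge> 0" "1 \<le> t"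
  shows "ml_combine experts out w S t \<in> X"
proof -
  have "ln (real (card experts)) > 0" using card_experts by simp
  thus ?thesis unfolding ml_combine_def using assms finite_experts card_experts out_in_X
    by (intro convex_sum convex_X sum_ml_prob ballI ml_prob_nonneg) auto
qed

lemma round_loss_unit:
  assumes "\<forall>j\<in>experts. w j > 0" "\<forall>j. S j \<ge> 0" "i \<in> experts"
  shows "0 \<le> round_loss t w S i \<and> round_loss t w S i \<le> 1"
proof (cases "t < T")
  case True
  have "norm (gF (Suc t) (ml_combine experts out w S (Suc t))) \<le> G"
    using True combine_in_X[OF assms(1,2)] by (intro grad_le) auto
  moreover have "dist (out i (Suc t)) xb \<le> D" using diameter out_in_X[OF assms(3)] xb_in_X by auto
  ultimately show ?thesis using usc_loss_unit G_pos D_pos True by (simp add: round_loss_def)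
qed (simp add: round_loss_def)

sublocale ml: adapt_ml_prod experts round_loss
  using finite_experts card_experts round_loss_unit by unfold_locales auto

definition point :: "nat \<Rightarrow> 'a" where
  "point t = ml_combine experts out (ml.w t) (ml.S t) (Suc t)"

lemma point_in_X: "point t \<in> X"
  unfolding point_def using ml.w_pos ml.S_nonneg by (intro combine_in_X) auto

lemma usc_state_eq: "t \<le> T \<Longrightarrow> usc_state experts out gF G D xb t = ml_prod_state experts round_loss t"
proof (induction t)
  case (Suc t)
  obtain w S where "ml_prod_state experts round_loss t = (w, S)" by fastforce
  thus ?case using Suc by (simp add: round_loss_def Let_def)
qed simp

lemma USC_Suc: "t < T \<Longrightarrow> USC Astr Aexp Acon T G D xb F gF (Suc t) = point t"
  using usc_state_eq[of t]
  by (simp add: USC_def experts_def[symmetric] out_def[abs_def] point_def ml.w_def ml.S_def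
      case_prod_unfold Let_def)

lemma ml_regret_eq:
  assumes "k \<in> experts" "t < T"
  shows "ml.lb t - ml.L t k = gF (Suc t) (point t) \<bullet> (point t - out k (Suc t)) / (2 * G * D)"
proof -
  have L: "ml.L t = (\<lambda>i. usc_loss G D xb (gF (Suc t) (point t)) (out i (Suc t)))"
    using assms(2) by (simp add: ml.L_def round_loss_def point_def)
  have "ml.lb t = usc_loss G D xb (gF (Suc t) (point t)) (point t)"
    unfolding ml.lb_def L
    by (subst sum_usc_loss[OF finite_experts ml.sum_prob[OF ml.w_pos]]) (simp add: point_def ml_combine_def)
  thus ?thesis using G_pos D_pos by (simp add: L usc_loss_diff)
qed

abbreviation "\<Gamma> \<equiv> usc_Gamma (card experts) T"

lemma linearized_regret_le:
  assumes k: "k \<in> experts"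
  shows "(\<Sum>t<T. gF (Suc t) (point t) \<bullet> (point t - out k (Suc t)))
    \<le> 2 * \<Gamma> * G * D * (2 + 1 / sqrt (ln (real (card experts))))
      + \<Gamma> * G / sqrt (ln (real (card experts))) * sqrt (\<Sum>t<T. (norm (point t - out k (Suc t)))\<^sup>2)"
proof -
  define q where "q = sqrt (ln (real (card experts)))"
  define r where "r t = ml.lb t - ml.L t k" for t
  define d where "d t = norm (point t - out k (Suc t))" for t
  have q: "q > 0" using ml.ln_n_pos by (simp add: q_def)
  have r_le: "(r t)\<^sup>2 \<le> (d t / (2 * D))\<^sup>2" if t: "t < T" for t
  proof -
    have "norm (gF (Suc t) (point t)) \<le> G" using t point_in_X by (intro grad_le) auto
    hence "\<bar>gF (Suc t) (point t) \<bullet> (point t - out k (Suc t))\<bar> \<le> G * d t"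
      unfolding d_def by (meson Cauchy_Schwarz_ineq2 mult_right_mono norm_ge_zero order_trans)
    hence "\<bar>r t\<bar> \<le> d t / (2 * D)"
      using G_pos D_pos by (simp add: r_def ml_regret_eq[OF k t] abs_divide field_simps)
    hence "\<bar>r t\<bar>\<^sup>2 \<le> (d t / (2 * D))\<^sup>2" by (intro power_mono) auto
    thus ?thesis by simp
  qed
  have "sqrt (\<Sum>t<T. (r t)\<^sup>2) \<le> sqrt (\<Sum>t<T. (d t / (2 * D))\<^sup>2)"
    by (intro real_sqrt_le_mono sum_mono r_le) auto
  also have "\<dots> = sqrt ((\<Sum>t<T. (d t)\<^sup>2) / (2 * D)\<^sup>2)"
    by (simp add: power_divide sum_divide_distrib)
  also have "\<dots> = sqrt (\<Sum>t<T. (d t)\<^sup>2) / (2 * D)"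
    using D_pos by (simp only: real_sqrt_divide real_sqrt_abs abs_of_pos mult_pos_pos zero_less_numeral)
  finally have "\<Gamma> / q * sqrt (\<Sum>t<T. (r t)\<^sup>2) \<le> \<Gamma> / q * (sqrt (\<Sum>t<T. (d t)\<^sup>2) / (2 * D))"
    using q usc_Gamma_nonneg[OF card_experts] by (intro mult_left_mono) auto
  hence "(\<Sum>t<T. r t) \<le> \<Gamma> * (2 + 1 / q) + \<Gamma> / q * (sqrt (\<Sum>t<T. (d t)\<^sup>2) / (2 * D))"
    using ml.regret_le_second_order[OF k, of T] unfolding r_def q_def by linarith
  hence "2 * G * D * (\<Sum>t<T. r t)
      \<le> 2 * G * D * (\<Gamma> * (2 + 1 / q) + \<Gamma> / q * (sqrt (\<Sum>t<T. (d t)\<^sup>2) / (2 * D)))"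
    using G_pos D_pos by (intro mult_left_mono) auto
  moreover have "2 * G * D * (\<Sum>t<T. r t) = (\<Sum>t<T. gF (Suc t) (point t) \<bullet> (point t - out k (Suc t)))"
    using G_pos D_pos by (simp add: sum_distrib_left r_def ml_regret_eq[OF k])
  ultimately show ?thesis using D_pos by (simp add: q_def d_def field_simps)
qed

lemma regret_le_expert:
  assumes strong: "\<forall>t\<in>{1..T}. strongly_convex_grad X (F t) (gF t) lam"
    and lam: "lam > 0" and k: "k \<in> experts"
  shows "regret X T F (USC Astr Aexp Acon T G D xb F gF)
    \<le> regret X T F (out k) + 2 * \<Gamma> * G * D * (2 + 1 / sqrt (ln (real (card experts))))
      + \<Gamma>\<^sup>2 * G\<^sup>2 / (2 * lam * ln (real (card experts)))"
proof -
  define q where "q = sqrt (ln (real (card experts)))"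
  define d where "d t = norm (point t - out k (Suc t))" for t
  define DD where "DD = (\<Sum>t<T. (d t)\<^sup>2)"
  have q: "q > 0" "q\<^sup>2 = ln (real (card experts))" using ml.ln_n_pos by (simp_all add: q_def)
  have step: "F (Suc t) (point t) - F (Suc t) (out k (Suc t))
      \<le> gF (Suc t) (point t) \<bullet> (point t - out k (Suc t)) - lam / 2 * (d t)\<^sup>2" if t: "t < T" for t
  proof -
    have "strongly_convex_grad X (F (Suc t)) (gF (Suc t)) lam" using strong t by auto
    moreover have "out k (Suc t) \<in> X" using out_in_X[OF k] by simp
    moreover have nd: "norm (out k (Suc t) - point t) = d t" by (simp add: d_def norm_minus_commute)
    ultimately have "F (Suc t) (out k (Suc t)) \<ge> F (Suc t) (point t)
        + gF (Suc t) (point t) \<bullet> (out k (Suc t) - point t) + lam / 2 * (d t)\<^sup>2"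
      using point_in_X[of t] unfolding strongly_convex_grad_def nd[symmetric] by blast
    moreover have "gF (Suc t) (point t) \<bullet> (out k (Suc t) - point t)
        = - (gF (Suc t) (point t) \<bullet> (point t - out k (Suc t)))"
      by (simp add: inner_diff_right)
    ultimately show ?thesis by linarith
  qed
  have "regret X T F (USC Astr Aexp Acon T G D xb F gF) - regret X T F (out k)
      = (\<Sum>t<T. F (Suc t) (point t) - F (Suc t) (out k (Suc t)))"
    by (simp add: regret_diff USC_Suc)
  also have "\<dots> \<le> (\<Sum>t<T. gF (Suc t) (point t) \<bullet> (point t - out k (Suc t)) - lam / 2 * (d t)\<^sup>2)"
    using step by (intro sum_mono) auto
  also have "\<dots> = (\<Sum>t<T. gF (Suc t) (point t) \<bullet> (point t - out k (Suc t))) - lam / 2 * DD"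
    by (simp add: DD_def sum_subtractf sum_distrib_left)
  also have "\<dots> \<le> 2 * \<Gamma> * G * D * (2 + 1 / q) + (\<Gamma> * G / q * sqrt DD - lam / 2 * DD)"
    using linearized_regret_le[OF k] by (simp add: q_def d_def DD_def)
  also have "\<Gamma> * G / q * sqrt DD - lam / 2 * DD \<le> (\<Gamma> * G / q)\<^sup>2 / (2 * lam)"
    using lam by (intro mult_sqrt_minus_le) (auto simp: DD_def intro: sum_nonneg)
  also have "(\<Gamma> * G / q)\<^sup>2 / (2 * lam) = \<Gamma>\<^sup>2 * G\<^sup>2 / (2 * lam * ln (real (card experts)))"
    by (simp add: power_divide power_mult_distrib q(2))
  finally show ?thesis by (simp add: q_def)
qed

end

theorem theorem1:
  fixes X :: "'a::euclidean_space set"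
    and D G lam :: real and T :: nat
    and F :: "'a fseq" and gF :: "nat \<Rightarrow> 'a \<Rightarrow> 'a"
    and Astr Aexp :: "'a param_alg set" and Acon :: "'a online_alg set"
    and R :: "'a param_alg \<Rightarrow> real \<Rightarrow> real"
    and xb :: 'a
  assumes T2: "T \<ge> 2"
    and X: "X \<noteq> {}" "closed X" "convex X" "\<forall>x\<in>X. \<forall>y\<in>X. dist x y \<le> D"
    and GD: "G > 0" "D > 0"
    and setting: "oco_setting X G T F gF"
    and lam: "1 / real T \<le> lam" "lam \<le> 1"
    and strong: "\<forall>t\<in>{1..T}. strongly_convex_grad X (F t) (gF t) lam"
    and algs: "finite Astr" "Astr \<noteq> {}" "finite Aexp" "finite Acon"
      "\<forall>A\<in>Astr. \<forall>l>0. is_online_alg X (A l)"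
      "\<forall>A\<in>Aexp. \<forall>a>0. is_online_alg X (A a)"
      "\<forall>A\<in>Acon. is_online_alg X A"
    and Rbound: "\<forall>A\<in>Astr. \<forall>l>0. is_str_regret_bound X G T A l (R A l)"
    and xb: "xb \<in> X"
  shows "(\<exists>lh\<in>Pgrid T. lh \<le> lam \<and> lam \<le> 2 * lh) \<and>
    (\<forall>lh\<in>Pgrid T. lh \<le> lam \<and> lam \<le> 2 * lh \<longrightarrow>
      (let nE = card (usc_experts Astr Aexp Acon T); \<Gamma> = usc_Gamma nE T in
        regret X T F (USC Astr Aexp Acon T G D xb F gF)
          \<le> Min ((\<lambda>A. R A lh) ` Astr)
             + 2 * \<Gamma> * G * D * (2 + 1 / sqrt (ln (real nE)))
             + \<Gamma>\<^sup>2 * G\<^sup>2 / (2 * lam * ln (real nE))))"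
proof (intro conjI ballI impI)
  show "\<exists>lh\<in>Pgrid T. lh \<le> lam \<and> lam \<le> 2 * lh" using Pgrid_bracket[OF T2 lam] .
next
  fix lh assume lh: "lh \<in> Pgrid T" "lh \<le> lam \<and> lam \<le> 2 * lh"
  interpret usc_run X G D T F gF Astr Aexp Acon xb
    using T2 X GD setting algs xb by unfold_locales (auto simp: oco_setting_def)
  have lh_pos: "lh > 0" using Pgrid_pos[OF _ lh(1)] T2 by simp
  have "Min ((\<lambda>A. R A lh) ` Astr) \<in> (\<lambda>A. R A lh) ` Astr" using algs(1,2) by simp
  then obtain A where A: "A \<in> Astr" "R A lh = Min ((\<lambda>A. R A lh) ` Astr)" by force
  have "EStr A lh \<in> experts" using A lh unfolding experts_def usc_experts_def by auto
  moreover have "regret X T F (out (EStr A lh)) \<le> R A lh"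
  proof -
    have "\<forall>t\<in>{1..T}. strongly_convex_grad X (F t) (gF t) lh"
      using strong lh(2) strongly_convex_grad_mono by blast
    moreover have "is_str_regret_bound X G T A lh (R A lh)" using Rbound A(1) lh_pos by blast
    ultimately show ?thesis using setting unfolding is_str_regret_bound_def out_def by auto
  qed
  ultimately show "let nE = card (usc_experts Astr Aexp Acon T); \<Gamma> = usc_Gamma nE T in
        regret X T F (USC Astr Aexp Acon T G D xb F gF)
          \<le> Min ((\<lambda>A. R A lh) ` Astr) + 2 * \<Gamma> * G * D * (2 + 1 / sqrt (ln (real nE)))
             + \<Gamma>\<^sup>2 * G\<^sup>2 / (2 * lam * ln (real nE))"
    using regret_le_expert[OF strong, of "EStr A lh"] lh_pos lh(2) A(2)
    unfolding Let_def experts_def[symmetric] by linarith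
qed

end
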